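(* Let $G$ be an infinite, non-discrete topological group, let $p \in G \setminus \{1\}$, and let $Q$ be a proper dense subgroup of $G$. (1) There is a subgroup $M$ of $G$ such that $p \notin M$, $Q \subseteq M$, and for every $x \in G \setminus M$ one has $p \in \langle M, x\rangle$. (2) If $G$ is compact and Abelian, then every subgroup $M$ of $G$ such that $p \notin M$, $Q \subseteq M$, and $p \in \langle M, x\rangle$ for every $x \in G \setminus M$, is non-measurable with respect to the normalized Haar measure of $G$.
   Context: Topological groups are assumed Hausdorff. The identity element of $G$ is denoted by $1$. For a subgroup $M$ of $G$ and $x \in G$, $\langle M, x\rangle$ denotes the subgroup of $G$ generated by $M \cup \{x\}$. Every compact group $G$ carries a unique translation-invariant (regular Borel) probability measure, its normalized Haar measure. A subset of $G$ is called measurable if it belongs to the domain of the completion of this measure (so every subset of a set of Haar measure $0$ is measurable), and non-measurable otherwise.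
   Formalization: Part (1) is stated with the additional assumption that p does not belong to Q; without it the claim is false, since no M can contain Q and omit p when p lies in Q (e.g. the circle, Q the roots of unity, p = -1). *)

theory Defs
  imports "HOL-Algebra.Generated_Groups" "HOL-Probability.Probability_Measure"
begin

text \<open>As usual in this subject, topological groups are Hausdorff by definition.\<close>

locale topological_group = group G for G (structure) +
  fixes T :: "'a topology"
  assumes topspace_eq_carrier: "topspace T = carrier G"
    and continuous_mult: "continuous_map (prod_topology T T) T (\<lambda>(x, y). x \<otimes> y)"
    and continuous_inv: "continuous_map T T (\<lambda>x. inv x)"
    and Hausdorff: "Hausdorff_space T"

definition dense_in :: "'a topology \<Rightarrow> 'a set \<Rightarrow> bool" where
  "dense_in T S \<longleftrightarrow> S \<subseteq> topspace T \<and> T closure_of S = topspace T"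

definition borel_measure_on :: "'a topology \<Rightarrow> 'a measure \<Rightarrow> bool" where
  "borel_measure_on T \<mu> \<longleftrightarrow>
     space \<mu> = topspace T \<and> sets \<mu> = sigma_sets (topspace T) {U. openin T U}"

definition regular_borel_measure :: "'a topology \<Rightarrow> 'a measure \<Rightarrow> bool" where
  "regular_borel_measure T \<mu> \<longleftrightarrow> borel_measure_on T \<mu> \<and>
     (\<forall>A\<in>sets \<mu>. emeasure \<mu> A = (INF U\<in>{U. openin T U \<and> A \<subseteq> U}. emeasure \<mu> U)
              \<and> emeasure \<mu> A = (SUP K\<in>{K. compactin T K \<and> K \<subseteq> A}. emeasure \<mu> K))"

text \<open>On a compact group there is exactly one such measure, so quantifying over all \<open>\<mu>\<close>
  with this property amounts to speaking about the normalized Haar measure.\<close>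

definition normalized_haar_measure ::
    "('a, 'b) monoid_scheme \<Rightarrow> 'a topology \<Rightarrow> 'a measure \<Rightarrow> bool" where
  "normalized_haar_measure G T \<mu> \<longleftrightarrow>
     prob_space \<mu> \<and> regular_borel_measure T \<mu> \<and>
     (\<forall>x\<in>carrier G. \<forall>A\<in>sets \<mu>.
        emeasure \<mu> (x <#\<^bsub>G\<^esub> A) = emeasure \<mu> A \<and> emeasure \<mu> (A #>\<^bsub>G\<^esub> x) = emeasure \<mu> A)"

end

theory Submission
  imports Defs
begin

text \<open>
  Why the theorem holds. Part (1) is Zorn's lemma: a subgroup that is maximal among those which
  contain \<open>Q\<close> and omit \<open>p\<close> has the required property, because any larger subgroup has to
  contain \<open>p\<close>; when \<open>p \<notin> Q\<close>, the subgroup \<open>Q\<close> itself is one of them.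

  For part (2) suppose that such an \<open>M\<close> were measurable, and look at its size.

  If \<open>M\<close> is a null set, then so are its cosets, and a contradiction arises once there are only
  countably many of them. The quotient \<open>G / M\<close> is an Abelian group in which every nontrivial
  element has the image of \<open>p\<close> among its powers. Such a group is countable
  (\<open>countable_if_common_power\<close>): it is a torsion group, every subgroup of prime order equals the
  one generated by the image of \<open>p\<close>, and so an induction on the number of prime factors of
  \<open>n\<close> shows that only countably many elements have exponent \<open>n\<close>.

  If \<open>M\<close> is not a null set, then by inner regularity it contains a compact set \<open>K\<close> of positive
  measure. The argument of Steinhaus yields a neighbourhood of the identity inside
  \<open>K K\<^sup>-\<^sup>1 \<subseteq> M\<close>; since \<open>M\<close> contains the dense set \<open>Q\<close>, it follows that \<open>M\<close> is the
  whole group, although \<open>p \<notin> M\<close>.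
\<close>

section \<open>Maximal subgroups omitting an element\<close>

lemma (in group) subgroup_Union_chain:
  assumes "\<C> \<noteq> {}" and sub: "\<And>H. H \<in> \<C> \<Longrightarrow> subgroup H G"
    and chain: "\<And>H K. H \<in> \<C> \<Longrightarrow> K \<in> \<C> \<Longrightarrow> H \<subseteq> K \<or> K \<subseteq> H"
  shows "subgroup (\<Union>\<C>) G"
proof (rule subgroupI)
  show "\<Union>\<C> \<subseteq> carrier G"
    using sub subgroup.subset by blast
  show "\<Union>\<C> \<noteq> {}"
    using assms(1) sub subgroup.one_closed by blast
  show "inv a \<in> \<Union>\<C>" if a: "a \<in> \<Union>\<C>" for a
  proof -
    obtain H where "H \<in> \<C>" "a \<in> H"
      using a by blast
    then show ?thesis
      using subgroup.m_inv_closed[OF sub] by blast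
  qed
  show "a \<otimes> b \<in> \<Union>\<C>" if ab: "a \<in> \<Union>\<C>" "b \<in> \<Union>\<C>" for a b
  proof -
    obtain H K where "H \<in> \<C>" "a \<in> H" "K \<in> \<C>" "b \<in> K"
      using ab by blast
    with chain[of H K] obtain L where L: "L \<in> \<C>" "a \<in> L" "b \<in> L"
      by blast
    have "a \<otimes> b \<in> L"
      using subgroup.m_closed[OF sub] L by simp
    with L(1) show ?thesis by blast
  qed
qed

lemma (in group) exists_maximal_subgroup_omitting:
  assumes Q: "subgroup Q G" "p \<notin> Q"
  shows "\<exists>M. subgroup M G \<and> p \<notin> M \<and> Q \<subseteq> M \<and>
           (\<forall>x \<in> carrier G - M. p \<in> generate G (M \<union> {x}))"
proof -
  define \<A> where "\<A> = {H. subgroup H G \<and> p \<notin> H \<and> Q \<subseteq> H}"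
  have "\<exists>M\<in>\<A>. \<forall>H\<in>\<A>. M \<subseteq> H \<longrightarrow> H = M"
  proof (rule subset_Zorn_nonempty)
    show "\<A> \<noteq> {}"
      using Q by (auto simp: \<A>_def)
    fix \<C> assume ne: "\<C> \<noteq> {}" and ch: "subset.chain \<A> \<C>"
    have inA: "\<C> \<subseteq> \<A>" and cmp: "\<And>H K. H \<in> \<C> \<Longrightarrow> K \<in> \<C> \<Longrightarrow> H \<subseteq> K \<or> K \<subseteq> H"
      using ch by (auto simp: subset_chain_def)
    have "subgroup (\<Union>\<C>) G"
      using ne inA cmp by (intro subgroup_Union_chain) (auto simp: \<A>_def)
    then show "\<Union>\<C> \<in> \<A>"
      using ne inA by (auto simp: \<A>_def)
  qed
  then obtain M where M: "subgroup M G" "p \<notin> M" "Q \<subseteq> M"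
    and max: "\<And>H. H \<in> \<A> \<Longrightarrow> M \<subseteq> H \<Longrightarrow> H = M"
    by (auto simp: \<A>_def)
  have "p \<in> generate G (M \<union> {x})" if x: "x \<in> carrier G - M" for x
  proof (rule ccontr)
    assume np: "p \<notin> generate G (M \<union> {x})"
    have sub: "M \<union> {x} \<subseteq> generate G (M \<union> {x})"
      by (auto intro: generate.incl)
    have "M \<union> {x} \<subseteq> carrier G"
      using subgroup.subset[OF M(1)] x by blast
    then have "generate G (M \<union> {x}) \<in> \<A>"
      using np sub M(3) generate_is_subgroup by (auto simp: \<A>_def)
    then show False
      using max sub x by blast
  qed
  with M show ?thesis by blast
qed

section \<open>Abelian groups in which all nontrivial elements have a common power\<close>

lemma countable_if_countable_fibres:
  assumes "countable B" "f ` A \<subseteq> B" "\<And>b. b \<in> B \<Longrightarrow> countable {x \<in> A. f x = b}"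
  shows "countable A"
proof -
  have "A = (\<Union>b\<in>B. {x \<in> A. f x = b})"
    using assms(2) by blast
  then show ?thesis
    using countable_UN[OF assms(1), of "\<lambda>b. {x \<in> A. f x = b}"] assms(3) by simp
qed

text \<open>The map \<open>x \<mapsto> x\<^sup>r\<close> sends the \<open>r * n\<close>-torsion to the \<open>n\<close>-torsion, and each of its
  fibres is a translate of a subset of the \<open>r\<close>-torsion. So countability passes to products of
  exponents.\<close>

lemma (in comm_group) countable_torsion_mult:
  fixes r n :: nat
  assumes r: "countable {x \<in> carrier G. x [^] r = \<one>}"
    and n: "countable {x \<in> carrier G. x [^] n = \<one>}"
  shows "countable {x \<in> carrier G. x [^] (r * n) = \<one>}" (is "countable ?A")
proof (rule countable_if_countable_fibres[OF n])
  show "(\<lambda>x. x [^] r) ` ?A \<subseteq> {x \<in> carrier G. x [^] n = \<one>}"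
    by (auto simp: nat_pow_pow)
  fix b
  let ?F = "{x \<in> ?A. x [^] r = b}"
  show "countable ?F"
  proof (cases "?F = {}")
    case False
    then obtain y where y: "y \<in> carrier G" "y [^] r = b"
      by blast
    have "?F \<subseteq> (\<lambda>t. y \<otimes> t) ` {x \<in> carrier G. x [^] r = \<one>}"
    proof
      fix x assume x: "x \<in> ?F"
      have "(inv y \<otimes> x) [^] r = \<one>"
        using x y by (auto simp: nat_pow_distrib nat_pow_inv)
      moreover have "x = y \<otimes> (inv y \<otimes> x)"
        using x y by (simp add: m_assoc[symmetric])
      ultimately show "x \<in> (\<lambda>t. y \<otimes> t) ` {x \<in> carrier G. x [^] r = \<one>}"
        using x y by blast
    qed
    then show ?thesis
      using r by (meson countable_image countable_subset)
  qed (simp only: countable_empty)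
qed

text \<open>If the exponent \<open>r\<close> is prime, the passage from a nontrivial \<open>x\<close> to its power \<open>p\<close> can be
  reversed: \<open>p = x\<^sup>k\<close> with \<open>r\<close> not dividing \<open>k\<close>, so a Bezout relation exhibits \<open>x\<close> as a
  power of \<open>p\<close>.\<close>

lemma (in group) countable_prime_torsion:
  fixes r :: nat
  assumes "p \<noteq> \<one>" and r: "prime r"
    and pow: "\<And>x. x \<in> carrier G \<Longrightarrow> x \<noteq> \<one> \<Longrightarrow> \<exists>k::int. p = x [^] k"
  shows "countable {x \<in> carrier G. x [^] r = \<one>}"
proof (rule countable_subset)
  show "countable (insert \<one> (range (\<lambda>a::int. p [^] a)))"
    by simp
  show "{x \<in> carrier G. x [^] r = \<one>} \<subseteq> insert \<one> (range (\<lambda>a::int. p [^] a))"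
  proof clarify
    fix x assume x: "x \<in> carrier G" "x [^] r = \<one>"
      and nr: "x \<notin> range (\<lambda>a::int. p [^] a)"
    have xr: "x [^] (int r * j) = \<one>" for j :: int
      using x by (simp add: int_pow_pow[symmetric] int_pow_int)
    show "x = \<one>"
    proof (rule ccontr)
      assume "x \<noteq> \<one>"
      then obtain k :: int where k: "p = x [^] k"
        using pow x by blast
      have "\<not> int r dvd k"
        using k xr \<open>p \<noteq> \<one>\<close> by (auto elim!: dvdE)
      then have "coprime (int r) k"
        using r by (simp add: prime_imp_coprime)
      then obtain a b where ab: "int r * a + k * b = 1"
        by (metis bezout_int coprime_imp_gcd_eq_1 mult.commute)
      have "x = x [^] (int r * a + k * b)"
        unfolding ab using x(1) by simp
      also have "\<dots> = x [^] (int r * a) \<otimes> x [^] (k * b)"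
        using x by (simp add: int_pow_mult)
      also have "\<dots> = p [^] b"
        using x k xr by (simp add: int_pow_pow)
      finally show False
        using nr by blast
    qed
  qed
qed

text \<open>Since \<open>p\<close> is a power of its own square (or the square is trivial), \<open>p\<close> has finite order;
  every \<open>x\<close> has \<open>p\<close> among its powers, so it has finite order too. Hence the group is the union
  over \<open>n > 0\<close> of its \<open>n\<close>-torsion parts, whose countability follows by induction over the
  prime factorization of \<open>n\<close>. (These groups are exactly the nontrivial subgroups of the Pruefer
  groups.)\<close>

lemma (in comm_group) countable_if_common_power:
  assumes p: "p \<in> carrier G" "p \<noteq> \<one>"
    and gen: "\<And>x. x \<in> carrier G \<Longrightarrow> x \<noteq> \<one> \<Longrightarrow> p \<in> generate G {x}"
  shows "countable (carrier G)"
proof -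
  have pow: "\<exists>k::int. p = x [^] k" if "x \<in> carrier G" "x \<noteq> \<one>" for x
    using gen[OF that] generate_pow[OF that(1)] by auto
  \<comment> \<open>If \<open>p\<^sup>2\<close> is nontrivial, then \<open>p\<close> is a power of it, that is, an even power of itself.\<close>
  obtain j :: int where j: "j \<noteq> 0" "p [^] j = \<one>"
  proof (cases "p [^] (2::int) = \<one>")
    case True
    then show thesis
      using that[of 2] by simp
  next
    case False
    then obtain k :: int where "p = (p [^] (2::int)) [^] k"
      using pow p by blast
    then have "p = p [^] (2 * k)"
      using p by (simp add: int_pow_pow)
    then have "p [^] (2 * k - 1) = \<one>"
      using p by (simp add: int_pow_diff)
    moreover have "2 * k - 1 \<noteq> 0"
      by presburger
    ultimately show thesis
      using that by blast
  qed
  have tors: "\<exists>n::nat. n > 0 \<and> x [^] n = \<one>" if x: "x \<in> carrier G" for x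
  proof (cases "x = \<one>")
    case True
    then show ?thesis
      by (intro exI[of _ 1]) simp
  next
    case False
    then obtain k :: int where k: "p = x [^] k"
      using pow x by blast
    have "k \<noteq> 0"
      using k p by (metis int_pow_0)
    have one: "x [^] (k * j) = \<one>"
      using k j x by (simp add: int_pow_pow)
    have "x [^] \<bar>k * j\<bar> = \<one>"
      using one x by (cases "k * j \<ge> 0") (simp_all add: int_pow_neg abs_if)
    then have "x [^] nat \<bar>k * j\<bar> = \<one>"
      by (metis abs_ge_zero int_nat_eq int_pow_int)
    moreover have "nat \<bar>k * j\<bar> > 0"
      using \<open>k \<noteq> 0\<close> j by simp
    ultimately show ?thesis
      by blast
  qed
  have "n > 0 \<longrightarrow> countable {x \<in> carrier G. x [^] n = \<one>}" for n :: nat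
  proof (induction n rule: prime_divisors_induct)
    case zero
    then show ?case by simp
  next
    case (unit n)
    have "n = 1"
      using unit by simp
    then have "{x \<in> carrier G. x [^] n = \<one>} \<subseteq> {\<one>}"
      by auto
    then show ?case
      by (simp add: countable_subset[where B = "{\<one>}"])
  next
    case (factor r n)
    have "countable {x \<in> carrier G. x [^] r = \<one>}"
      using countable_prime_torsion[OF p(2) factor.hyps(1) pow] .
    with factor show ?case
      by (auto intro: countable_torsion_mult)
  qed
  then have "countable (\<Union>n\<in>{0<..}. {x \<in> carrier G. x [^] (n::nat) = \<one>})"
    by (intro countable_UN) auto
  moreover have "carrier G \<subseteq> (\<Union>n\<in>{0<..}. {x \<in> carrier G. x [^] (n::nat) = \<one>})"
    using tors by blast
  ultimately show ?thesis
    by (rule countable_subset[rotated])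
qed

text \<open>In the quotient the elements of \<open>M\<close> become trivial, so that \<open>p \<in> \<langle>M, x\<rangle>\<close> says that the
  coset of \<open>p\<close> is a power of the coset of \<open>x\<close>.\<close>

lemma (in comm_group) countable_rcosets_if_maximal_omitting:
  assumes M: "subgroup M G" and p: "p \<in> carrier G" "p \<notin> M"
    and gen: "\<And>x. x \<in> carrier G - M \<Longrightarrow> p \<in> generate G (M \<union> {x})"
  shows "countable (rcosets M)"
proof -
  interpret N: normal M G
    by (rule subgroup_imp_normal[OF M])
  interpret F: comm_group "G Mod M"
    by (rule abelian_FactGroup[OF M])
  interpret h: group_hom G "G Mod M" "\<lambda>a. M #> a"
    by unfold_locales (rule N.r_coset_hom_Mod)
  have "countable (carrier (G Mod M))"
  proof (rule F.countable_if_common_power)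
    show "M #> p \<in> carrier (G Mod M)"
      using p by simp
    show "M #> p \<noteq> \<one>\<^bsub>G Mod M\<^esub>"
      using p coset_join1[OF _ p(1) M] N.subset by auto
    fix X assume X: "X \<in> carrier (G Mod M)" "X \<noteq> \<one>\<^bsub>G Mod M\<^esub>"
    then obtain x where x: "x \<in> carrier G" "X = M #> x"
      by (auto simp: carrier_FactGroup)
    have "x \<notin> M"
      using X x coset_join2[OF x(1) M] by auto
    have "M #> p \<in> (\<lambda>a. M #> a) ` generate G (M \<union> {x})"
      using gen x \<open>x \<notin> M\<close> by blast
    also have "\<dots> = generate (G Mod M) ((\<lambda>a. M #> a) ` (M \<union> {x}))"
      using x N.subset by (intro h.generate_img[symmetric]) auto
    also have "\<dots> \<subseteq> generate (G Mod M) {X}"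
    proof (rule F.generate_subgroup_incl)
      show "subgroup (generate (G Mod M) {X}) (G Mod M)"
        using X by (intro F.generate_is_subgroup) auto
      have "M #> a = M" if "a \<in> M" for a
        using that coset_join2[OF N.mem_carrier M] by blast
      then show "(\<lambda>a. M #> a) ` (M \<union> {x}) \<subseteq> generate (G Mod M) {X}"
        using x generate.one[of "G Mod M" "{X}"] generate.incl[of X "{X}" "G Mod M"] by auto
    qed
    finally show "M #> p \<in> generate (G Mod M) {X}" .
  qed
  then show ?thesis
    by (simp add: FactGroup_def)
qed

section \<open>Dense subgroups and invariant measures\<close>

context topological_group
begin

lemma continuous_map_left_mult:
  assumes "a \<in> carrier G"
  shows "continuous_map T T (\<lambda>x. a \<otimes> x)"
proof -
  have "continuous_map T (prod_topology T T) (\<lambda>x. (a, x))"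
    using assms topspace_eq_carrier by (simp add: continuous_map_pairedI)
  from continuous_map_compose[OF this continuous_mult] show ?thesis
    by (simp add: o_def)
qed

lemma continuous_map_right_mult:
  assumes "a \<in> carrier G"
  shows "continuous_map T T (\<lambda>x. x \<otimes> a)"
proof -
  have "continuous_map T (prod_topology T T) (\<lambda>x. (x, a))"
    using assms topspace_eq_carrier by (simp add: continuous_map_pairedI)
  from continuous_map_compose[OF this continuous_mult] show ?thesis
    by (simp add: o_def)
qed

text \<open>The neighbourhood \<open>{x. inv x \<otimes> g \<in> V}\<close> of \<open>g\<close> meets the dense set, in \<open>q\<close> say, and then
  \<open>g = q \<otimes> (inv q \<otimes> g)\<close> is a product of two elements of \<open>M\<close>.\<close>

lemma dense_subgroup_with_interior_eq_carrier:
  assumes M: "subgroup M G" and D: "dense_in T D" "D \<subseteq> M"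
    and V: "openin T V" "\<one> \<in> V" "V \<subseteq> M"
  shows "M = carrier G"
proof
  show "M \<subseteq> carrier G"
    by (rule subgroup.subset[OF M])
  show "carrier G \<subseteq> M"
  proof
    fix g assume g: "g \<in> carrier G"
    have "continuous_map T T (\<lambda>x. inv x \<otimes> g)"
      using continuous_map_compose[OF continuous_inv continuous_map_right_mult[OF g]]
      by (simp add: o_def)
    then have opn: "openin T {x \<in> carrier G. inv x \<otimes> g \<in> V}"
      using openin_continuous_map_preimage[OF _ V(1)] topspace_eq_carrier by fastforce
    have mem: "g \<in> {x \<in> carrier G. inv x \<otimes> g \<in> V}"
      using g V(2) by simp
    have "g \<in> T closure_of D"
      using D g topspace_eq_carrier by (simp add: dense_in_def)
    then have "\<exists>q. q \<in> D \<and> q \<in> W" if "g \<in> W" "openin T W" for W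
      using that by (simp add: in_closure_of)
    from this[OF mem opn]
    obtain q where q: "q \<in> D" "q \<in> carrier G" "inv q \<otimes> g \<in> V"
      by blast
    then have "q \<in> M" "inv q \<otimes> g \<in> M"
      using D V by auto
    then have "q \<otimes> (inv q \<otimes> g) \<in> M"
      by (rule subgroup.m_closed[OF M])
    then show "g \<in> M"
      using q g by (simp add: m_assoc[symmetric])
  qed
qed

lemma compactin_neighbourhood_of_one:
  assumes K: "compactin T K" "K \<subseteq> U" and U: "openin T U"
  obtains V where "openin T V" "\<one> \<in> V" "\<forall>v\<in>V. \<forall>k\<in>K. v \<otimes> k \<in> U"
proof -
  let ?W = "{z \<in> topspace (prod_topology T T). (case z of (x, y) \<Rightarrow> x \<otimes> y) \<in> U}"
  have Ksub: "K \<subseteq> carrier G"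
    using K compactin_subset_topspace topspace_eq_carrier by metis
  have W: "openin (prod_topology T T) ?W"
    by (rule openin_continuous_map_preimage[OF continuous_mult U])
  have one: "compactin T {\<one>}"
    using topspace_eq_carrier by simp
  have sub: "{\<one>} \<times> K \<subseteq> ?W"
    using Ksub K(2) topspace_eq_carrier by (auto simp: subset_iff)
  obtain V V' where V: "openin T V" "openin T V'" "{\<one>} \<subseteq> V" and V': "K \<subseteq> V'" "V \<times> V' \<subseteq> ?W"
    by (rule Wallace_theorem_prod_topology[OF one K(1) W sub])
  show thesis
  proof
    show "openin T V" "\<one> \<in> V"
      using V by auto
    show "\<forall>v\<in>V. \<forall>k\<in>K. v \<otimes> k \<in> U"
    proof (intro ballI)
      fix v k assume "v \<in> V" "k \<in> K"
      then have "(v, k) \<in> ?W"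
        using V' by blast
      then show "v \<otimes> k \<in> U" by simp
    qed
  qed
qed

lemma borel_right_translate:
  assumes \<mu>: "borel_measure_on T \<mu>" and A: "A \<in> sets \<mu>" and x: "x \<in> carrier G"
  shows "A #> x \<in> sets \<mu>"
proof -
  have sp: "space \<mu> = carrier G"
    and st: "sets \<mu> = sigma_sets (carrier G) {U. openin T U}"
    using \<mu> topspace_eq_carrier by (simp_all add: borel_measure_on_def)
  have Asub: "A \<subseteq> carrier G"
    using A sets.sets_into_space sp by metis
  have "(\<lambda>y. y \<otimes> inv x) \<in> measurable \<mu> \<mu>"
  proof (rule measurable_sigma_sets[OF st])
    show "{U. openin T U} \<subseteq> Pow (carrier G)"
      using openin_subset topspace_eq_carrier by auto
    show "(\<lambda>y. y \<otimes> inv x) \<in> space \<mu> \<rightarrow> carrier G"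
      using x sp by auto
    fix U assume "U \<in> {U. openin T U}"
    then have "openin T {y \<in> topspace T. y \<otimes> inv x \<in> U}"
      using openin_continuous_map_preimage[OF continuous_map_right_mult] x by blast
    moreover have "(\<lambda>y. y \<otimes> inv x) -` U \<inter> space \<mu> = {y \<in> topspace T. y \<otimes> inv x \<in> U}"
      using sp topspace_eq_carrier by auto
    ultimately show "(\<lambda>y. y \<otimes> inv x) -` U \<inter> space \<mu> \<in> sets \<mu>"
      using st by auto
  qed
  then have "(\<lambda>y. y \<otimes> inv x) -` A \<inter> space \<mu> \<in> sets \<mu>"
    using A by (rule measurable_sets)
  moreover have "(\<lambda>y. y \<otimes> inv x) -` A \<inter> space \<mu> = A #> x"
  proof (intro equalityI subsetI)
    fix y assume y: "y \<in> (\<lambda>y. y \<otimes> inv x) -` A \<inter> space \<mu>"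
    then have "y = (y \<otimes> inv x) \<otimes> x"
      using x sp by (simp add: m_assoc)
    then show "y \<in> A #> x"
      using y unfolding r_coset_def by blast
  next
    fix y assume "y \<in> A #> x"
    then show "y \<in> (\<lambda>y. y \<otimes> inv x) -` A \<inter> space \<mu>"
      using x sp Asub by (auto simp: r_coset_def m_assoc subset_iff)
  qed
  ultimately show ?thesis by simp
qed

text \<open>If countably many translates of a null set covered the group, the group
  itself would be null.\<close>

lemma subgroup_of_countable_index_not_null:
  assumes \<mu>: "normalized_haar_measure G T \<mu>" and M: "subgroup M G"
    and cnt: "countable (rcosets M)" and B: "B \<in> null_sets \<mu>"
  shows "\<not> M \<subseteq> B"
proof
  assume MB: "M \<subseteq> B"
  interpret prob_space \<mu>
    using \<mu> by (simp add: normalized_haar_measure_def)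
  have bor: "borel_measure_on T \<mu>"
    using \<mu> by (simp add: normalized_haar_measure_def regular_borel_measure_def)
  have sp: "space \<mu> = carrier G"
    using bor topspace_eq_carrier by (simp add: borel_measure_on_def)
  have "\<exists>C\<in>null_sets \<mu>. X \<subseteq> C" if X: "X \<in> rcosets M" for X
  proof -
    obtain x where x: "x \<in> carrier G" "X = M #> x"
      using X by (auto simp: RCOSETS_def)
    have "emeasure \<mu> (B #> x) = emeasure \<mu> B"
      using \<mu> x B by (auto simp: normalized_haar_measure_def)
    then have "B #> x \<in> null_sets \<mu>"
      using borel_right_translate[OF bor _ x(1)] B by (auto simp: null_sets_def)
    moreover have "X \<subseteq> B #> x"
      using x MB by (auto simp: r_coset_def)
    ultimately show ?thesis by blast
  qed
  then obtain C where C: "\<And>X. X \<in> rcosets M \<Longrightarrow> C X \<in> null_sets \<mu> \<and> X \<subseteq> C X"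
    by metis
  have null: "(\<Union>X\<in>rcosets M. C X) \<in> null_sets \<mu>"
    using cnt C by (intro null_sets_UN') auto
  have "\<Union>(rcosets M) \<subseteq> (\<Union>X\<in>rcosets M. C X)"
    using C by (intro Union_least) auto
  then have "space \<mu> \<subseteq> (\<Union>X\<in>rcosets M. C X)"
    using sp rcosets_part_G[OF M] by simp
  then have "space \<mu> \<in> null_sets \<mu>"
    by (rule null_sets_subset[OF null sets.top])
  then have "emeasure \<mu> (space \<mu>) = 0"
    by (rule null_setsD1)
  then show False
    using emeasure_space_1 by simp
qed

text \<open>The theorem of Steinhaus. Choose an open \<open>U \<supseteq> K\<close> with \<open>\<mu> U < 2 * \<mu> K\<close>. Translating \<open>K\<close>
  by an element \<open>v\<close> close to the identity keeps it inside \<open>U\<close>, where there is no room for two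
  disjoint copies of \<open>K\<close>; a common point of \<open>v K\<close> and \<open>K\<close> exhibits \<open>v\<close> as a quotient of two
  elements of \<open>K\<close>.\<close>

lemma Steinhaus_compact:
  assumes \<mu>: "normalized_haar_measure G T \<mu>"
    and K: "compactin T K" "emeasure \<mu> K > 0"
  obtains V where "openin T V" "\<one> \<in> V" "\<forall>v\<in>V. \<exists>a\<in>K. \<exists>b\<in>K. v = a \<otimes> inv b"
proof -
  interpret prob_space \<mu>
    using \<mu> by (simp add: normalized_haar_measure_def)
  have sp: "space \<mu> = carrier G" and st: "sets \<mu> = sigma_sets (topspace T) {U. openin T U}"
    using \<mu> topspace_eq_carrier
    by (simp_all add: normalized_haar_measure_def regular_borel_measure_def borel_measure_on_def)
  have open_sets: "U \<in> sets \<mu>" if "openin T U" for U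
    using that st by auto
  have compact_sets: "C \<in> sets \<mu>" if "compactin T C" for C
  proof -
    have "closedin T C"
      using Hausdorff that by (rule compactin_imp_closedin)
    then have "openin T (topspace T - C)" "C \<subseteq> topspace T"
      by (auto simp: closedin_def)
    then have "space \<mu> - (topspace T - C) \<in> sets \<mu>"
      using open_sets by blast
    then show ?thesis
      using \<open>C \<subseteq> topspace T\<close> sp topspace_eq_carrier by (simp add: double_diff)
  qed
  have Ksub: "K \<subseteq> carrier G"
    using K compactin_subset_topspace topspace_eq_carrier by metis
  have outer: "emeasure \<mu> K = (INF U\<in>{U. openin T U \<and> K \<subseteq> U}. emeasure \<mu> U)"
    using \<mu> compact_sets[OF K(1)]
    by (auto simp: normalized_haar_measure_def regular_borel_measure_def)
  have "emeasure \<mu> K < emeasure \<mu> K + emeasure \<mu> K"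
    using K(2) by (simp add: emeasure_eq_measure ennreal_less_iff flip: ennreal_plus)
  then have "(INF U\<in>{U. openin T U \<and> K \<subseteq> U}. emeasure \<mu> U) < emeasure \<mu> K + emeasure \<mu> K"
    by (simp only: outer[symmetric])
  then obtain U where U: "openin T U" "K \<subseteq> U"
      and small: "emeasure \<mu> U < emeasure \<mu> K + emeasure \<mu> K"
    unfolding INF_less_iff by blast
  obtain V where V: "openin T V" "\<one> \<in> V" and VK: "\<forall>v\<in>V. \<forall>k\<in>K. v \<otimes> k \<in> U"
    by (rule compactin_neighbourhood_of_one[OF K(1) U(2,1)])
  have "\<exists>a\<in>K. \<exists>b\<in>K. v = a \<otimes> inv b" if v: "v \<in> V" for v
  proof -
    have vG: "v \<in> carrier G"
      using v V openin_subset topspace_eq_carrier by blast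
    have vK: "v <# K = (\<lambda>k. v \<otimes> k) ` K"
      by (auto simp: l_coset_def)
    then have "v <# K \<in> sets \<mu>"
      using compact_sets image_compactin[OF K(1) continuous_map_left_mult[OF vG]] by simp
    have meas: "emeasure \<mu> (v <# K) = emeasure \<mu> K"
      using \<mu> vG compact_sets[OF K(1)] by (auto simp: normalized_haar_measure_def)
    have "(v <# K) \<inter> K \<noteq> {}"
    proof
      assume "(v <# K) \<inter> K = {}"
      then have "emeasure \<mu> K + emeasure \<mu> K = emeasure \<mu> ((v <# K) \<union> K)"
        using plus_emeasure[OF \<open>v <# K \<in> sets \<mu>\<close> compact_sets[OF K(1)]] meas by simp
      also have "\<dots> \<le> emeasure \<mu> U"
        using vK VK v U by (intro emeasure_mono open_sets) auto
      finally show False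
        using small by simp
    qed
    then obtain b where b: "b \<in> K" "v \<otimes> b \<in> K"
      unfolding vK by blast
    then have "v = (v \<otimes> b) \<otimes> inv b"
      using vG Ksub by (auto simp: m_assoc subset_iff)
    then show ?thesis
      using b by blast
  qed
  with V that show thesis by simp
qed

lemma dense_subgroup_not_measurable:
  assumes \<mu>: "normalized_haar_measure G T \<mu>"
    and M: "subgroup M G" "M \<noteq> carrier G" and D: "dense_in T D" "D \<subseteq> M"
    and cnt: "countable (rcosets M)"
  shows "M \<notin> sets (completion \<mu>)"
proof
  assume "M \<in> sets (completion \<mu>)"
  then obtain S N N' where S: "M = S \<union> N" "N \<subseteq> N'" "N' \<in> null_sets \<mu>" "S \<in> sets \<mu>"
    by (rule sets_completionE)
  have "S \<notin> null_sets \<mu>"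
  proof
    assume "S \<in> null_sets \<mu>"
    then have "S \<union> N' \<in> null_sets \<mu>"
      using S by auto
    then show False
      using subgroup_of_countable_index_not_null[OF \<mu> M(1) cnt] S by blast
  qed
  then have "0 < emeasure \<mu> S"
    using S by (auto simp: null_sets_def zero_less_iff_neq_zero)
  also have "emeasure \<mu> S = (SUP K\<in>{K. compactin T K \<and> K \<subseteq> S}. emeasure \<mu> K)"
    using \<mu> S by (auto simp: normalized_haar_measure_def regular_borel_measure_def)
  finally obtain K where K: "compactin T K" "K \<subseteq> S" "0 < emeasure \<mu> K"
    by (auto simp: less_SUP_iff)
  obtain V where V: "openin T V" "\<one> \<in> V"
    and VK: "\<forall>v\<in>V. \<exists>a\<in>K. \<exists>b\<in>K. v = a \<otimes> inv b"
    by (rule Steinhaus_compact[OF \<mu> K(1,3)])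
  have "K \<subseteq> M"
    using K S by blast
  have "V \<subseteq> M"
  proof
    fix v assume "v \<in> V"
    then obtain a b where "a \<in> M" "b \<in> M" "v = a \<otimes> inv b"
      using VK \<open>K \<subseteq> M\<close> by blast
    then show "v \<in> M"
      using subgroup.m_closed[OF M(1)] subgroup.m_inv_closed[OF M(1)] by simp
  qed
  with M(2) show False
    using dense_subgroup_with_interior_eq_carrier[OF M(1) D V] by simp
qed

end

section \<open>Existence and non-measurability\<close>

theorem theorem3p1:
  fixes G :: "('a, 'b) monoid_scheme" and T :: "'a topology"
    and p :: 'a and Q :: "'a set"
  assumes "topological_group G T"
    and "infinite (carrier G)"
    and "T \<noteq> discrete_topology (carrier G)"
    and "p \<in> carrier G - {\<one>\<^bsub>G\<^esub>}"
    and "subgroup Q G" and "Q \<noteq> carrier G" and "dense_in T Q"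
  shows "(p \<notin> Q \<longrightarrow>
           (\<exists>M. subgroup M G \<and> p \<notin> M \<and> Q \<subseteq> M \<and>
              (\<forall>x \<in> carrier G - M. p \<in> generate G (M \<union> {x}))))
       \<and> (compact_space T \<and> comm_group G \<longrightarrow>
           (\<forall>\<mu>. normalized_haar_measure G T \<mu> \<longrightarrow>
             (\<forall>M. subgroup M G \<and> p \<notin> M \<and> Q \<subseteq> M \<and>
                (\<forall>x \<in> carrier G - M. p \<in> generate G (M \<union> {x})) \<longrightarrow>
                M \<notin> sets (completion \<mu>))))"
proof (intro conjI impI allI)
  interpret topological_group G T
    by (rule assms(1))
  show "\<exists>M. subgroup M G \<and> p \<notin> M \<and> Q \<subseteq> M \<and>
          (\<forall>x \<in> carrier G - M. p \<in> generate G (M \<union> {x}))" if "p \<notin> Q"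
    using exists_maximal_subgroup_omitting[OF assms(5) that] .
  fix \<mu> M
  assume comm: "compact_space T \<and> comm_group G" and \<mu>: "normalized_haar_measure G T \<mu>"
    and M: "subgroup M G \<and> p \<notin> M \<and> Q \<subseteq> M \<and>
              (\<forall>x \<in> carrier G - M. p \<in> generate G (M \<union> {x}))"
  have "countable (rcosets\<^bsub>G\<^esub> M)"
    using comm M assms(4) by (intro comm_group.countable_rcosets_if_maximal_omitting[of G M p]) auto
  moreover have "M \<noteq> carrier G"
    using M assms(4) by blast
  ultimately show "M \<notin> sets (completion \<mu>)"
    using dense_subgroup_not_measurable[OF \<mu>, of M Q] M assms(7) by blast
qed

end
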